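(* Let a four-digit year, a month of that year and a day of the week be given, in the Gregorian calendar (dates from 15 October 1582 onwards). Let $W$ be the code of the day of the week, $M$ the code of the month, $C$ the code of the century and $Y$ the code of the year (codes as defined in the context). Then the dates in the given month which fall on the given day of the week are determined by the formula $$D=[W-(M+C+Y)]\bmod 7 .$$ If the year is a leap year and the month is January or February, then the formula is instead $$D=[W-(M+C+Y)+1]\bmod 7 .$$ Here $D$ is the first date in the month that falls on the given day of the week, and the other such dates are obtained by repeatedly adding $7$ to $D$ until the last such date of the month is reached.
   Context: Here $x\bmod n$ denotes the remainder of $x$ on division by $n$, taken in $\{0,1,\dots,n-1\}$ (for example $(-9)\bmod 7=5$). Leap years: a year is a leap year if it is divisible by 4, except that a century year (a year divisible by 100) is a leap year only if it is divisible by 400 as well. Codes: Day of the week code $W$: Saturday $0$, Sunday $1$, Monday $2$, Tuesday $3$, Wednesday $4$, Thursday $5$, Friday $6$. Month code $M$: January $0$, February $3$, March $3$, April $6$, May $1$, June $4$, July $6$, August $2$, September $5$, October $0$, November $3$, December $5$. (In the formulas these same codes are used in leap years; the term $+1$ in the second formula accounts for January and February of leap years.) Century code $C$: if $c$ is the number formed by the first two digits of the four-digit year, then $C=[2(3-(c\bmod 4))+1]\bmod 7$; that is, $C=0,5,3,1$ when $c\bmod 4=0,1,2,3$ respectively. Year code $Y$: if $y$ is the number formed by the last two digits of the four-digit year, then $Y=(y+\lfloor y/4\rfloor)\bmod 7$.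
   Formalization: When D = 0 (not a date), the first such date is taken to be 7 rather than D; for October 1582, whose Gregorian dates start on the 15th, only the set of dates D + 7k is asserted, not that D is the first date. *)

theory Defs
  imports Main
begin

datatype weekday =
  Saturday | Sunday | Monday | Tuesday | Wednesday | Thursday | Friday

datatype month =
  January | February | March | April | May | June | July |
  August | September | October | November | December

definition leap_year :: "int \<Rightarrow> bool" where
  "leap_year y \<longleftrightarrow> 4 dvd y \<and> (100 dvd y \<longrightarrow> 400 dvd y)"

fun days_in_month :: "int \<Rightarrow> month \<Rightarrow> int" where
  "days_in_month y January = 31"
| "days_in_month y February = (if leap_year y then 29 else 28)"
| "days_in_month y March = 31"
| "days_in_month y April = 30"
| "days_in_month y May = 31"
| "days_in_month y June = 30"
| "days_in_month y July = 31"
| "days_in_month y August = 31"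
| "days_in_month y September = 30"
| "days_in_month y October = 31"
| "days_in_month y November = 30"
| "days_in_month y December = 31"

(* The dates (day numbers) of month m of year y in the Gregorian calendar, which begins
   on 15 October 1582; October 1582 thus contributes only the dates 15, ..., 31, and
   earlier months contribute none. *)
definition gregorian_dates :: "int \<Rightarrow> month \<Rightarrow> int set" where
  "gregorian_dates y m =
     {d. 1 \<le> d \<and> d \<le> days_in_month y m \<and>
         (y > 1582 \<or> y = 1582 \<and> (m = October \<and> d \<ge> 15 \<or> m \<in> {November, December}))}"

fun next_weekday :: "weekday \<Rightarrow> weekday" where
  "next_weekday Saturday = Sunday"
| "next_weekday Sunday = Monday"
| "next_weekday Monday = Tuesday"
| "next_weekday Tuesday = Wednesday"
| "next_weekday Wednesday = Thursday"
| "next_weekday Thursday = Friday"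
| "next_weekday Friday = Saturday"

(* Cyclic: the year is advanced separately, in next_date. *)
fun next_month :: "month \<Rightarrow> month" where
  "next_month January = February"
| "next_month February = March"
| "next_month March = April"
| "next_month April = May"
| "next_month May = June"
| "next_month June = July"
| "next_month July = August"
| "next_month August = September"
| "next_month September = October"
| "next_month October = November"
| "next_month November = December"
| "next_month December = January"

(* Dates are triples (year, month, day of the month). *)
fun next_date :: "int \<times> month \<times> int \<Rightarrow> int \<times> month \<times> int" where
  "next_date (y, m, d) =
     (if d < days_in_month y m then (y, m, d + 1)
      else if m = December then (y + 1, January, 1)
      else (y, next_month m, 1))"

(* The historical anchor of the calendar is that its first day, 15 October 1582, was a
   Friday; from there the days of the week follow one another without interruption. *)
inductive falls_on :: "int \<times> month \<times> int \<Rightarrow> weekday \<Rightarrow> bool" where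
  first_day: "falls_on (1582, October, 15) Friday"
| next_day: "falls_on dt w \<Longrightarrow> falls_on (next_date dt) (next_weekday w)"

fun weekday_code :: "weekday \<Rightarrow> int" where
  "weekday_code Saturday = 0"
| "weekday_code Sunday = 1"
| "weekday_code Monday = 2"
| "weekday_code Tuesday = 3"
| "weekday_code Wednesday = 4"
| "weekday_code Thursday = 5"
| "weekday_code Friday = 6"

fun month_code :: "month \<Rightarrow> int" where
  "month_code January = 0"
| "month_code February = 3"
| "month_code March = 3"
| "month_code April = 6"
| "month_code May = 1"
| "month_code June = 4"
| "month_code July = 6"
| "month_code August = 2"
| "month_code September = 5"
| "month_code October = 0"
| "month_code November = 3"
| "month_code December = 5"

(* For a four-digit year y, the first two digits form y div 100 and the last two
   y mod 100. *)
definition century_code :: "int \<Rightarrow> int" where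
  "century_code y = (let c = y div 100 in (2 * (3 - c mod 4) + 1) mod 7)"

definition year_code :: "int \<Rightarrow> int" where
  "year_code y = (let r = y mod 100 in (r + r div 4) mod 7)"

(* The number D lies in {0, ..., 6}. The value 0 is not itself a date; the first date of the
   progression D, D + 7, ... is then 7. *)
definition date_number :: "int \<Rightarrow> month \<Rightarrow> weekday \<Rightarrow> int" where
  "date_number y m w =
     (let W = weekday_code w; M = month_code m; C = century_code y; Y = year_code y
      in if leap_year y \<and> m \<in> {January, February}
         then (W - (M + C + Y) + 1) mod 7
         else (W - (M + C + Y)) mod 7)"

end

(* Write date_number as (W - month_offset) mod 7. Modulo 7, the codes C + Y of a year y add up to
   y + y div 4 - y div 100 + y div 400, which grows by 1 in passing to a common year and by 2 in
   passing to a leap year. Hence the congruence W = month_offset + d (mod 7) is preserved by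
   passing to the next day, and it holds on 15 October 1582. Since every later date is reached
   from there, the congruence determines the day of the week of every date. *)
theory Submission
  imports Defs
begin

text \<open>Modulo 7 this is the weekday code of the day before the first of the month. The
  subtracted 1 absorbs the correction for January and February of leap years, so that the two
  formulas for D become one.\<close>

definition month_offset :: "int \<Rightarrow> month \<Rightarrow> int" where
  "month_offset y m = month_code m + century_code y + year_code y
     - (if leap_year y \<and> m \<in> {January, February} then 1 else 0)"

lemma date_number_eq: "date_number y m w = (weekday_code w - month_offset y m) mod 7"
  unfolding date_number_def month_offset_def Let_def by (auto simp: algebra_simps)

section \<open>Leap years and the codes of century and year\<close>

definition leap_count :: "int \<Rightarrow> int" where
  "leap_count y = y div 4 - y div 100 + y div 400"

text \<open>For y >= 0, \<open>leap_count y\<close> is the number of leap years from 1 to y. With y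
  = 100c + r, c = 4q + p and s = r div 4, the sum on the right is 124c + q + r + s. Since 124c + q =
  126c - 7q - 2p, it is congruent to (7 - 2p) + (r + s), whose summands reduce to the two
  codes.\<close>

lemma century_year_code_mod7:
  "(century_code y + year_code y) mod 7 = (y + leap_count y) mod 7"
proof -
  define c r where "c = y div 100" and "r = y mod 100"
  define p q s where "p = c mod 4" and "q = c div 4" and "s = r div 4"
  have y: "y = 100 * c + r" by (simp add: c_def r_def)
  have c: "c = 4 * q + p" by (simp add: p_def q_def)
  have "y = r + 25 * c * 4" using y by simp
  then have div4: "y div 4 = s + 25 * c"
    by (simp only: s_def div_mult_self1 zero_neq_numeral not_False_eq_True ac_simps)
  have div400: "y div 400 = q"
    using zdiv_zmult2_eq[of 4 y 100] by (simp add: q_def c_def)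
  have "y + leap_count y = (2 * (3 - p) + 1) + (r + s) + 7 * (18 * c - q - 1)"
    unfolding leap_count_def div4 div400 c_def[symmetric] using y c by (simp add: algebra_simps)
  moreover have "(century_code y + year_code y) mod 7 = ((2 * (3 - p) + 1) + (r + s)) mod 7"
    unfolding century_code_def year_code_def Let_def p_def s_def c_def r_def
    by (simp only: mod_add_eq)
  ultimately show ?thesis
    by (simp only: mod_mult_self2)
qed

text \<open>The quotient of y by n grows by 1 exactly when n divides y + 1. As 400 is a multiple of
  100 and 100 of 4, the alternating sum of the three indicators is the indicator of a leap
  year.\<close>

lemma leap_count_Suc:
  "leap_count (y + 1) = leap_count y + (if leap_year (y + 1) then 1 else 0)"
proof -
  have div_Suc: "(y + 1) div n = y div n + (if n dvd y + 1 then 1 else 0)" if "n > 0" for n :: int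
  proof (cases "y mod n + 1 = n")
    case True
    then have eq: "y + 1 = n * (y div n + 1)"
      using mult_div_mod_eq[of n y] unfolding distrib_left by linarith
    then have "n dvd y + 1" by (rule dvdI)
    moreover from that have "(y + 1) div n = y div n + 1"
      unfolding eq by (intro nonzero_mult_div_cancel_left) simp
    ultimately show ?thesis by simp
  next
    case False
    have eq: "y + 1 = n * (y div n) + (y mod n + 1)" by simp
    have bounds: "0 \<le> y mod n + 1" "y mod n + 1 < n"
      using False pos_mod_bound[OF that, of y] pos_mod_sign[OF that, of y] by linarith+
    have "(y + 1) mod n = y mod n + 1" by (rule int_mod_pos_eq[OF eq bounds])
    then have "\<not> n dvd y + 1"
      using pos_mod_sign[OF that, of y] by (simp add: dvd_eq_mod_eq_0)
    then show ?thesis using int_div_pos_eq[OF eq bounds] by simp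
  qed
  have rearrange: "a + u - (b + v) + (c + w) = a - b + c + (u - v + w)" for a b c u v w :: int
    by simp
  have indicators: "(if p then 1 else 0) - (if q then 1 else 0) + (if r then 1 else 0)
      = (if p \<and> (q \<longrightarrow> r) then 1 else (0 :: int))"
    if "r \<Longrightarrow> q" "q \<Longrightarrow> p" for p q r
    using that by (cases p; cases q; cases r) simp_all
  have dvd_100: "100 dvd z" if "400 dvd z" for z :: int by (rule dvd_trans[OF _ that]) simp
  have dvd_4: "4 dvd z" if "100 dvd z" for z :: int by (rule dvd_trans[OF _ that]) simp
  show ?thesis
    unfolding leap_count_def leap_year_def div_Suc[OF zero_less_numeral] rearrange
    by (rule arg_cong[OF indicators]; erule dvd_100 dvd_4)
qed

section \<open>Month lengths and offsets of consecutive months\<close>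

lemma days_in_month_ge_28: "28 \<le> days_in_month y m"
  by (cases m) auto

text \<open>Century and year codes cancel, and the month codes grow by the common-year month lengths
  modulo 7. In a leap year the correction ends with March, which raises the offset by 1 and matches
  the 29th of February.\<close>

lemma month_offset_next_month:
  assumes "m \<noteq> December"
  shows "(month_offset y (next_month m) + 1) mod 7
    = (month_offset y m + days_in_month y m + 1) mod 7"
  using assms unfolding month_offset_def mod_eq_dvd_iff by (cases m) simp_all

lemma month_offset_new_year:
  "(month_offset (y + 1) January + 1) mod 7 = (month_offset y December + 32) mod 7"
proof -
  have "7 dvd century_code z + year_code z - (z + leap_count z)" for z
    using century_year_code_mod7[of z] by (simp only: mod_eq_dvd_iff)
  from dvd_diff[OF this[of "y + 1"] this[of y]]
  \<comment> \<open>Here 35 = 5 + 31 - 1: the code and the length of December, less the 1 by which y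
    grows. The growth of \<open>leap_count\<close> cancels against the correction in the offset of
    January.\<close>
  have "7 dvd (century_code (y + 1) + year_code (y + 1) - (y + 1 + leap_count (y + 1)))
      - (century_code y + year_code y - (y + leap_count y)) - 35"
    by (rule dvd_diff) simp
  also have "\<dots> = month_offset (y + 1) January + 1 - (month_offset y December + 32)"
    by (simp add: month_offset_def leap_count_Suc)
  finally show ?thesis by (simp only: mod_eq_dvd_iff)
qed

section \<open>Weekday codes and the passage to the next day\<close>

lemma weekday_code_next: "weekday_code (next_weekday w) = (weekday_code w + 1) mod 7"
  by (cases w) auto

lemma weekday_code_mod7: "weekday_code w mod 7 = weekday_code w"
  by (cases w) auto

lemma weekday_code_inject: "weekday_code v = weekday_code w \<Longrightarrow> v = w"
  by (cases v; cases w) auto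

lemma next_date_in_gregorian_dates:
  assumes "d \<in> gregorian_dates y m" "next_date (y, m, d) = (y', m', d')"
  shows "d' \<in> gregorian_dates y' m'"
proof -
  have "1 \<le> days_in_month y' m'" using days_in_month_ge_28[of y' m'] by simp
  then show ?thesis
    using assms unfolding gregorian_dates_def by (cases m) (auto split: if_splits)
qed

lemma next_date_month_offset:
  assumes "d \<in> gregorian_dates y m" "next_date (y, m, d) = (y', m', d')"
  shows "(month_offset y' m' + d') mod 7 = (month_offset y m + d + 1) mod 7"
proof (cases "d < days_in_month y m")
  case True
  then show ?thesis using assms by (auto simp: add.assoc)
next
  case False
  with assms(1) have "d = days_in_month y m" by (auto simp: gregorian_dates_def)
  then show ?thesis
    using assms(2) month_offset_next_month[of m y] month_offset_new_year[of y]
    by (auto simp: add.commute split: if_splits)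
qed

text \<open>Both claims go through one induction, because the congruence step relies on the validity
  of the preceding date.\<close>

lemma falls_on_code:
  assumes "falls_on (y, m, d) w"
  shows "d \<in> gregorian_dates y m \<and> weekday_code w = (month_offset y m + d) mod 7"
  using assms
proof (induction "(y, m, d)" w arbitrary: y m d rule: falls_on.induct)
  case first_day
  \<comment> \<open>The codes of October, century 15 and year 82 are 0, 1 and 4; 5 + 15 = 20 leaves
    6, the code of Friday.\<close>
  show ?case
    by (simp add: gregorian_dates_def month_offset_def century_code_def year_code_def leap_year_def)
next
  case (next_day dt w)
  obtain y0 m0 d0 where dt: "dt = (y0, m0, d0)" by (cases dt)
  have "weekday_code (next_weekday w) = (month_offset y0 m0 + d0 + 1) mod 7"
    using next_day(2)[OF dt] by (simp add: weekday_code_next mod_add_left_eq)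
  then show ?case
    using next_day(2)[OF dt] next_day(3) next_date_in_gregorian_dates next_date_month_offset
    unfolding dt by metis
qed

section \<open>Reachability of every date\<close>

lemma falls_on_later_in_month:
  assumes "\<exists>w. falls_on (y, m, d) w" "d \<le> d'" "d' \<le> days_in_month y m"
  shows "\<exists>w. falls_on (y, m, d') w"
  using assms(2,3)
proof (induction d' rule: int_ge_induct)
  case base
  show ?case by (fact assms(1))
next
  case (step i)
  then obtain w where "falls_on (y, m, i) w" by auto
  from falls_on.next_day[OF this] step.prems show ?case by auto
qed

lemma falls_on_next_month:
  assumes "\<exists>w. falls_on (y, m, d) w" "m \<noteq> December"
  shows "\<exists>w. falls_on (y, next_month m, 1) w"
proof -
  \<comment> \<open>A reachable date is valid, so the last day of its month can be reached from
    it.\<close>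
  have "d \<le> days_in_month y m"
    using assms(1) falls_on_code by (auto simp: gregorian_dates_def)
  then obtain w where "falls_on (y, m, days_in_month y m) w"
    using falls_on_later_in_month[OF assms(1)] by blast
  from falls_on.next_day[OF this] assms(2) show ?thesis by auto
qed

lemma falls_on_new_year:
  assumes "\<exists>w. falls_on (y, December, 1) w"
  shows "\<exists>w. falls_on (y + 1, January, 1) w"
proof -
  obtain w where "falls_on (y, December, 31) w"
    using falls_on_later_in_month[OF assms, of 31] by auto
  from falls_on.next_day[OF this] show ?thesis by auto
qed

lemma falls_on_first_of_month:
  assumes "\<exists>w. falls_on (y, January, 1) w"
  shows "\<exists>w. falls_on (y, m, 1) w"
proof -
  \<comment> \<open>The months form a cycle, so the eleven passages from January to December are
    chained explicitly.\<close>
  note n = falls_on_next_month[where y = y]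
  note Jan = assms
  note Feb = n[OF Jan, simplified] note Mar = n[OF Feb, simplified]
  note Apr = n[OF Mar, simplified] note May = n[OF Apr, simplified]
  note Jun = n[OF May, simplified] note Jul = n[OF Jun, simplified]
  note Aug = n[OF Jul, simplified] note Sep = n[OF Aug, simplified]
  note Oct = n[OF Sep, simplified] note Nov = n[OF Oct, simplified]
  note Dec = n[OF Nov, simplified]
  show ?thesis
    by (cases m) (use Jan Feb Mar Apr May Jun Jul Aug Sep Oct Nov Dec in simp_all)
qed

lemma falls_on_1582:
  "\<exists>w. falls_on (1582, October, 15) w" "\<exists>w. falls_on (1582, November, 1) w"
  "\<exists>w. falls_on (1582, December, 1) w"
proof -
  show Oct: "\<exists>w. falls_on (1582, October, 15) w" using first_day by blast
  show Nov: "\<exists>w. falls_on (1582, November, 1) w"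
    using falls_on_next_month[OF Oct] by simp
  show "\<exists>w. falls_on (1582, December, 1) w"
    using falls_on_next_month[OF Nov] by simp
qed

lemma falls_on_January_1:
  assumes "1583 \<le> y"
  shows "\<exists>w. falls_on (y, January, 1) w"
  using assms
proof (induction y rule: int_ge_induct)
  case base
  show ?case using falls_on_new_year[OF falls_on_1582(3)] by simp
next
  case (step i)
  then show ?case using falls_on_new_year falls_on_first_of_month by blast
qed

text \<open>Only reachability matters here, so the weekday stays existential;
  \<open>falls_on_code\<close> determines it.\<close>

lemma falls_on_total:
  assumes "d \<in> gregorian_dates y m"
  shows "\<exists>w. falls_on (y, m, d) w"
proof -
  from assms consider "y > 1582" "1 \<le> d" | "y = 1582" "m = October" "15 \<le> d"
    | "y = 1582" "m \<in> {November, December}" "1 \<le> d"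
    by (auto simp: gregorian_dates_def)
  \<comment> \<open>The witness is the earliest date of the month: 15 in October 1582, otherwise
    1.\<close>
  then obtain d0 where "\<exists>w. falls_on (y, m, d0) w" "d0 \<le> d"
  proof cases
    case 1
    then show thesis
      using that[of 1] falls_on_first_of_month[OF falls_on_January_1[of y]] by simp
  next
    case 2
    then show thesis using that falls_on_1582(1) by blast
  next
    case 3
    then show thesis using that falls_on_1582(2,3) by blast
  qed
  then show ?thesis
    using falls_on_later_in_month assms by (simp add: gregorian_dates_def)
qed

section \<open>From the congruence to arithmetic progressions\<close>

lemma falls_on_iff:
  "falls_on (y, m, d) w \<longleftrightarrow>
     d \<in> gregorian_dates y m \<and> weekday_code w = (month_offset y m + d) mod 7"
  \<comment> \<open>Conversely, a valid date has some weekday; its code is the given residue, and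
    codes are injective.\<close>
  using falls_on_code falls_on_total weekday_code_inject by metis

lemma falls_on_iff_date_number:
  "falls_on (y, m, d) w \<longleftrightarrow> d \<in> gregorian_dates y m \<and> 7 dvd d - date_number y m w"
proof -
  have "weekday_code w = (month_offset y m + d) mod 7 \<longleftrightarrow> 7 dvd d - date_number y m w"
  proof -
    have "weekday_code w = (month_offset y m + d) mod 7
        \<longleftrightarrow> (month_offset y m + d) mod 7 = weekday_code w mod 7"
      by (auto simp: weekday_code_mod7)
    also have "\<dots> \<longleftrightarrow> d mod 7 = (weekday_code w - month_offset y m) mod 7"
      by (simp add: mod_eq_dvd_iff algebra_simps)
    finally show ?thesis
      by (simp add: date_number_eq mod_eq_dvd_iff[symmetric])
  qed
  then show ?thesis by (simp add: falls_on_iff)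
qed

lemma gregorian_dates_full_month:
  assumes "gregorian_dates y m \<noteq> {}" "(y, m) \<noteq> (1582, October)"
  shows "gregorian_dates y m = {1..days_in_month y m}"
  using assms by (auto simp: gregorian_dates_def)

text \<open>Since d - a > -7, a multiple of 7 of this form cannot be negative, so the quotient is a
  natural number.\<close>

lemma dvd_diff_iff_ex_nat:
  fixes a d :: int
  assumes "a < d + 7"
  shows "7 dvd d - a \<longleftrightarrow> (\<exists>k. d = a + 7 * int k)"
proof
  assume "7 dvd d - a"
  then obtain j where "d - a = 7 * j" ..
  with assms have "d = a + 7 * int (nat j)" by auto
  then show "\<exists>k. d = a + 7 * int k" ..
qed auto

theorem proposition4p1:
  fixes y :: int and m :: month and w :: weekday
  assumes four_digit: "1000 \<le> y" "y \<le> 9999"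
    and gregorian: "gregorian_dates y m \<noteq> {}"
  shows "let D = date_number y m w;
             S = {d. falls_on (y, m, d) w}
         in S = {D + 7 * int k | k. D + 7 * int k \<in> gregorian_dates y m} \<and>
            ((y, m) \<noteq> (1582, October) \<longrightarrow>
               (let f = (if D = 0 then 7 else D)
                in f \<in> S \<and> (\<forall>d\<in>S. f \<le> d) \<and>
                   S = {f + 7 * int k | k. f + 7 * int k \<le> days_in_month y m}))"
proof -
  define D where "D = date_number y m w"
  define S where "S = {d. falls_on (y, m, d) w}"
  \<comment> \<open>This is the representative of the class of D among 1, ..., 7, the dates of the
    first week.\<close>
  define f where "f = (if D = 0 then 7 else D)"
  have D: "0 \<le> D" "D < 7" by (simp_all add: D_def date_number_eq)
  have S: "d \<in> S \<longleftrightarrow> d \<in> gregorian_dates y m \<and> 7 dvd d - D" for d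
    by (simp add: S_def D_def falls_on_iff_date_number)
  have progression: "S = {D + 7 * int k | k. D + 7 * int k \<in> gregorian_dates y m}"
  proof -
    have "7 dvd d - D \<longleftrightarrow> (\<exists>k. d = D + 7 * int k)" if "d \<in> gregorian_dates y m" for d
      using that D by (intro dvd_diff_iff_ex_nat) (auto simp: gregorian_dates_def)
    then show ?thesis using S by blast
  qed
  \<comment> \<open>October 1582 is set apart because its dates start at 15, whereas f is at most
    7.\<close>
  have "f \<in> S \<and> (\<forall>d\<in>S. f \<le> d) \<and> S = {f + 7 * int k | k. f + 7 * int k \<le> days_in_month y m}"
    if "(y, m) \<noteq> (1582, October)"
  proof -
    have f: "1 \<le> f" "f \<le> 7" using D by (auto simp: f_def)
    have "7 dvd d - D \<longleftrightarrow> 7 dvd d - f" for d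
      unfolding f_def by (cases "D = 0") (simp, presburger, simp)
    moreover have "7 dvd d - f \<longleftrightarrow> (\<exists>k. d = f + 7 * int k)" if "1 \<le> d" for d
      using that f by (intro dvd_diff_iff_ex_nat) auto
    ultimately have S': "d \<in> S \<longleftrightarrow> 1 \<le> d \<and> d \<le> days_in_month y m \<and> (\<exists>k. d = f + 7 * int k)" for d
      using S gregorian_dates_full_month[OF gregorian that] by auto
    \<comment> \<open>Every month has at least 28 days, so f is one of its dates; it is the term
      with k = 0.\<close>
    have "f \<in> S"
      using f days_in_month_ge_28[of y m] unfolding S' by (auto intro: exI[of _ 0])
    moreover have "\<forall>d\<in>S. f \<le> d" using S' by auto
    moreover have "S = {f + 7 * int k | k. f + 7 * int k \<le> days_in_month y m}"
      using S' f by fastforce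
    ultimately show ?thesis by blast
  qed
  with progression show ?thesis
    unfolding Let_def D_def S_def f_def by blast
qed

end
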